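(* Let $\mathbb{C}_1,\dots,\mathbb{C}_n$ and $\mathbb{D}$ be comonads on categories $\mathcal{C}_1,\dots,\mathcal{C}_n$ and $\mathcal{D}$, each base category carrying a proper factorisation system and each comonad preserving embeddings, such that each of $\mathrm{EM}(\mathbb{C}_1),\dots,\mathrm{EM}(\mathbb{C}_n),\mathrm{EM}(\mathbb{D})$ is a path category (with the lifted factorisation system and some chosen class of paths) and $\mathrm{EM}(\mathbb{D})$ has equalisers. Let $H\colon\prod_i\mathcal{C}_i\to\mathcal{D}$ be a functor preserving embeddings, and suppose there is a Kleisli law $\kappa\colon\mathbb{D}\circ H\Rightarrow H\circ\prod_i\mathbb{C}_i$ satisfying (S2''): for every path $(P,\pi)$ in $\mathrm{EM}(\mathbb{D})$ and coalgebras $(A_i,\alpha_i)\in\mathrm{EM}(\mathbb{C}_i)$, every bimorphism $f\colon\pi\to[\vec\alpha]$ decomposes as $f=H(e_1,\dots,e_n)\circ f_0$ for some $f_0\colon P\to H(P_1,\dots,P_n)$ and some path embeddings $e_i\colon(P_i,\pi_i)\rightarrowtail(A_i,\alpha_i)$ in $\mathrm{EM}(\mathbb{C}_i)$. Then for all objects $A_i,B_i\in\mathcal{C}_i$, $$A_1\rightarrow^{e}_{\mathbb{C}_1}B_1,\ \dots,\ A_n\rightarrow^{e}_{\mathbb{C}_n}B_n\quad\text{implies}\quad H(A_1,\dots,A_n)\rightarrow^{e}_{\mathbb{D}}H(B_1,\dots,B_n).$$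
   Context: Comonad $(\mathbb{C},\varepsilon,\delta)$; coalgebras $(A,\alpha)$ with $\varepsilon_A\circ\alpha=\mathrm{id}$, $\delta_A\circ\alpha=\mathbb{C}(\alpha)\circ\alpha$; coalgebra morphisms; category $\mathrm{EM}(\mathbb{C})$; cofree coalgebra $F^{\mathbb{C}}(A)=(\mathbb{C}A,\delta_A)$. A proper factorisation system $(\mathcal{E},\mathcal{M})$: every morphism factors as $m\circ e$, the two classes are each other's weak-orthogonality classes, $\mathcal{E}$ epis, $\mathcal{M}$ monos; members of $\mathcal{M}$ are embeddings. Preserving embeddings: sending (tuples of) embeddings to embeddings. For $\mathbb{C}$ preserving embeddings, a coalgebra morphism is an embedding/quotient in the lifted system iff its underlying morphism is. A path category is a category with a proper factorisation system and a chosen class of path objects; a path embedding is an embedding with path domain; $f\colon X\to Y$ is a pathwise-embedding if $f\circ e$ is an embedding for all path embeddings $e$ into $X$. Write $A\rightarrow^{e}_{\mathbb{C}}B$ if there is a pathwise-embedding $F^{\mathbb{C}}(A)\to F^{\mathbb{C}}(B)$ in $\mathrm{EM}(\mathbb{C})$. A Kleisli law is a natural $\kappa$ with components $\kappa_{\vec A}\colon\mathbb{D}H(\vec A)\to H(\mathbb{C}_1A_1,\dots,\mathbb{C}_nA_n)$ with $H(\varepsilon_{A_1},\dots)\circ\kappa=\varepsilon_H$ and $H(\delta_{A_1},\dots)\circ\kappa_{\vec A}=\kappa_{\mathbb{C}\vec A}\circ\mathbb{D}(\kappa_{\vec A})\circ\delta_{H(\vec A)}$. A bimorphism $\alpha\to[\vec\beta]$,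 for a $\mathbb{D}$-coalgebra $(A,\alpha)$ and $\mathbb{C}_i$-coalgebras $(B_i,\beta_i)$, is $g\colon A\to H(\vec B)$ with $H(\beta_1,\dots,\beta_n)\circ g=\kappa_{\vec B}\circ\mathbb{D}(g)\circ\alpha$. *)

theory Defs
  imports Main
begin

section \<open>Categories, functors and natural transformations\<close>

text \<open>All data are total functions that are only meaningful on the carriers \<open>Ob\<close> and \<open>Arr\<close>
  and, for composition, on composable pairs. Composition is written in applicative order.\<close>

record ('o, 'm) cat =
  Ob :: "'o set"
  Arr :: "'m set"
  Dom :: "'m \<Rightarrow> 'o"
  Cod :: "'m \<Rightarrow> 'o"
  Ident :: "'o \<Rightarrow> 'm"
  Comp :: "'m \<Rightarrow> 'm \<Rightarrow> 'm" (infixr "\<cdot>\<index>" 70)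

definition hom :: "('o, 'm) cat \<Rightarrow> 'o \<Rightarrow> 'o \<Rightarrow> 'm set" where
  "hom C a b = {f \<in> Arr C. Dom C f = a \<and> Cod C f = b}"

definition category :: "('o, 'm) cat \<Rightarrow> bool" where
  "category C \<longleftrightarrow>
     (\<forall>f \<in> Arr C. Dom C f \<in> Ob C \<and> Cod C f \<in> Ob C) \<and>
     (\<forall>a \<in> Ob C. Ident C a \<in> hom C a a) \<and>
     (\<forall>f \<in> Arr C. \<forall>g \<in> Arr C. Cod C f = Dom C g \<longrightarrow>
        g \<cdot>\<^bsub>C\<^esub> f \<in> hom C (Dom C f) (Cod C g)) \<and>
     (\<forall>f \<in> Arr C. f \<cdot>\<^bsub>C\<^esub> Ident C (Dom C f) = f \<and> Ident C (Cod C f) \<cdot>\<^bsub>C\<^esub> f = f) \<and>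
     (\<forall>f \<in> Arr C. \<forall>g \<in> Arr C. \<forall>h \<in> Arr C. Cod C f = Dom C g \<longrightarrow> Cod C g = Dom C h \<longrightarrow>
        h \<cdot>\<^bsub>C\<^esub> (g \<cdot>\<^bsub>C\<^esub> f) = (h \<cdot>\<^bsub>C\<^esub> g) \<cdot>\<^bsub>C\<^esub> f)"

definition epic :: "('o, 'm) cat \<Rightarrow> 'm \<Rightarrow> bool" where
  "epic C e \<longleftrightarrow> e \<in> Arr C \<and>
     (\<forall>g \<in> Arr C. \<forall>h \<in> Arr C. Dom C g = Cod C e \<longrightarrow> Dom C h = Cod C e \<longrightarrow>
        g \<cdot>\<^bsub>C\<^esub> e = h \<cdot>\<^bsub>C\<^esub> e \<longrightarrow> g = h)"

definition monic :: "('o, 'm) cat \<Rightarrow> 'm \<Rightarrow> bool" where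
  "monic C m \<longleftrightarrow> m \<in> Arr C \<and>
     (\<forall>g \<in> Arr C. \<forall>h \<in> Arr C. Cod C g = Dom C m \<longrightarrow> Cod C h = Dom C m \<longrightarrow>
        m \<cdot>\<^bsub>C\<^esub> g = m \<cdot>\<^bsub>C\<^esub> h \<longrightarrow> g = h)"

definition equaliser :: "('o, 'm) cat \<Rightarrow> 'm \<Rightarrow> 'm \<Rightarrow> 'm \<Rightarrow> bool" where
  "equaliser C f g e \<longleftrightarrow> e \<in> Arr C \<and> Cod C e = Dom C f \<and> f \<cdot>\<^bsub>C\<^esub> e = g \<cdot>\<^bsub>C\<^esub> e \<and>
     (\<forall>h \<in> Arr C. Cod C h = Dom C f \<longrightarrow> f \<cdot>\<^bsub>C\<^esub> h = g \<cdot>\<^bsub>C\<^esub> h \<longrightarrow>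
        (\<exists>!k. k \<in> hom C (Dom C h) (Dom C e) \<and> e \<cdot>\<^bsub>C\<^esub> k = h))"

definition has_equalisers :: "('o, 'm) cat \<Rightarrow> bool" where
  "has_equalisers C \<longleftrightarrow>
     (\<forall>f \<in> Arr C. \<forall>g \<in> Arr C. Dom C f = Dom C g \<longrightarrow> Cod C f = Cod C g \<longrightarrow>
        (\<exists>e. equaliser C f g e))"

record ('o, 'm, 'p, 'n) fnctr =
  fob :: "'o \<Rightarrow> 'p"
  farr :: "'m \<Rightarrow> 'n"

definition is_functor :: "('o, 'm) cat \<Rightarrow> ('p, 'n) cat \<Rightarrow> ('o, 'm, 'p, 'n) fnctr \<Rightarrow> bool" where
  "is_functor C D F \<longleftrightarrow> category C \<and> category D \<and>
     (\<forall>a \<in> Ob C. fob F a \<in> Ob D) \<and>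
     (\<forall>f \<in> Arr C. farr F f \<in> hom D (fob F (Dom C f)) (fob F (Cod C f))) \<and>
     (\<forall>a \<in> Ob C. farr F (Ident C a) = Ident D (fob F a)) \<and>
     (\<forall>f \<in> Arr C. \<forall>g \<in> Arr C. Cod C f = Dom C g \<longrightarrow>
        farr F (g \<cdot>\<^bsub>C\<^esub> f) = farr F g \<cdot>\<^bsub>D\<^esub> farr F f)"

definition id_fun :: "('o, 'm, 'o, 'm) fnctr" where
  "id_fun = \<lparr>fob = \<lambda>a. a, farr = \<lambda>f. f\<rparr>"

definition comp_fun ::
  "('p, 'n, 'q, 'l) fnctr \<Rightarrow> ('o, 'm, 'p, 'n) fnctr \<Rightarrow> ('o, 'm, 'q, 'l) fnctr" where
  "comp_fun G F = \<lparr>fob = \<lambda>a. fob G (fob F a), farr = \<lambda>f. farr G (farr F f)\<rparr>"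

definition nat_trans :: "('o, 'm) cat \<Rightarrow> ('p, 'n) cat \<Rightarrow> ('o, 'm, 'p, 'n) fnctr \<Rightarrow>
    ('o, 'm, 'p, 'n) fnctr \<Rightarrow> ('o \<Rightarrow> 'n) \<Rightarrow> bool" where
  "nat_trans C D F G \<tau> \<longleftrightarrow> is_functor C D F \<and> is_functor C D G \<and>
     (\<forall>a \<in> Ob C. \<tau> a \<in> hom D (fob F a) (fob G a)) \<and>
     (\<forall>f \<in> Arr C. \<tau> (Cod C f) \<cdot>\<^bsub>D\<^esub> farr F f = farr G f \<cdot>\<^bsub>D\<^esub> \<tau> (Dom C f))"

text \<open>Finite products of categories: \<open>n\<close>-tuples are functions on an index type with \<open>n\<close> elements.\<close>

definition prod_cat :: "('i \<Rightarrow> ('o, 'm) cat) \<Rightarrow> ('i \<Rightarrow> 'o, 'i \<Rightarrow> 'm) cat" where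
  "prod_cat C =
     \<lparr>Ob = {A. \<forall>i. A i \<in> Ob (C i)},
      Arr = {f. \<forall>i. f i \<in> Arr (C i)},
      Dom = \<lambda>f i. Dom (C i) (f i),
      Cod = \<lambda>f i. Cod (C i) (f i),
      Ident = \<lambda>A i. Ident (C i) (A i),
      Comp = \<lambda>g f i. g i \<cdot>\<^bsub>C i\<^esub> f i\<rparr>"

definition prod_fun ::
  "('i \<Rightarrow> ('o, 'm, 'p, 'n) fnctr) \<Rightarrow> ('i \<Rightarrow> 'o, 'i \<Rightarrow> 'm, 'i \<Rightarrow> 'p, 'i \<Rightarrow> 'n) fnctr" where
  "prod_fun F = \<lparr>fob = \<lambda>A i. fob (F i) (A i), farr = \<lambda>f i. farr (F i) (f i)\<rparr>"

section \<open>Proper factorisation systems and path categories\<close>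

definition weakly_orthogonal :: "('o, 'm) cat \<Rightarrow> 'm \<Rightarrow> 'm \<Rightarrow> bool" where
  "weakly_orthogonal C e m \<longleftrightarrow>
     (\<forall>u \<in> hom C (Dom C e) (Dom C m). \<forall>v \<in> hom C (Cod C e) (Cod C m).
        v \<cdot>\<^bsub>C\<^esub> e = m \<cdot>\<^bsub>C\<^esub> u \<longrightarrow>
        (\<exists>d \<in> hom C (Cod C e) (Dom C m). d \<cdot>\<^bsub>C\<^esub> e = u \<and> m \<cdot>\<^bsub>C\<^esub> d = v))"

definition proper_factorisation_system :: "('o, 'm) cat \<Rightarrow> 'm set \<Rightarrow> 'm set \<Rightarrow> bool" where
  "proper_factorisation_system C E M \<longleftrightarrow> category C \<and>
     (\<forall>f \<in> Arr C. \<exists>e \<in> E. \<exists>m \<in> M. Cod C e = Dom C m \<and> f = m \<cdot>\<^bsub>C\<^esub> e) \<and>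
     E = {e \<in> Arr C. \<forall>m \<in> M. weakly_orthogonal C e m} \<and>
     M = {m \<in> Arr C. \<forall>e \<in> E. weakly_orthogonal C e m} \<and>
     (\<forall>e \<in> E. epic C e) \<and> (\<forall>m \<in> M. monic C m)"

definition path_category :: "('o, 'm) cat \<Rightarrow> 'm set \<Rightarrow> 'm set \<Rightarrow> 'o set \<Rightarrow> bool" where
  "path_category C E M P \<longleftrightarrow> proper_factorisation_system C E M \<and> P \<subseteq> Ob C"

definition path_embedding :: "('o, 'm) cat \<Rightarrow> 'm set \<Rightarrow> 'o set \<Rightarrow> 'm \<Rightarrow> bool" where
  "path_embedding C M P e \<longleftrightarrow> e \<in> M \<and> Dom C e \<in> P"

definition pathwise_embedding :: "('o, 'm) cat \<Rightarrow> 'm set \<Rightarrow> 'o set \<Rightarrow> 'm \<Rightarrow> bool" where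
  "pathwise_embedding C M P f \<longleftrightarrow> f \<in> Arr C \<and>
     (\<forall>e. path_embedding C M P e \<longrightarrow> Cod C e = Dom C f \<longrightarrow> f \<cdot>\<^bsub>C\<^esub> e \<in> M)"

definition preserves_embeddings :: "'m set \<Rightarrow> 'n set \<Rightarrow> ('o, 'm, 'p, 'n) fnctr \<Rightarrow> bool" where
  "preserves_embeddings M N F \<longleftrightarrow> (\<forall>m \<in> M. farr F m \<in> N)"

definition tuples :: "('i \<Rightarrow> 'm set) \<Rightarrow> ('i \<Rightarrow> 'm) set" where
  "tuples M = {m. \<forall>i. m i \<in> M i}"

section \<open>Comonads and coalgebras\<close>

record ('o, 'm) cmnd =
  cfun :: "('o, 'm, 'o, 'm) fnctr"
  counit :: "'o \<Rightarrow> 'm"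
  comult :: "'o \<Rightarrow> 'm"

definition comonad :: "('o, 'm) cat \<Rightarrow> ('o, 'm) cmnd \<Rightarrow> bool" where
  "comonad C W \<longleftrightarrow>
     nat_trans C C (cfun W) id_fun (counit W) \<and>
     nat_trans C C (cfun W) (comp_fun (cfun W) (cfun W)) (comult W) \<and>
     (\<forall>a \<in> Ob C.
        counit W (fob (cfun W) a) \<cdot>\<^bsub>C\<^esub> comult W a = Ident C (fob (cfun W) a) \<and>
        farr (cfun W) (counit W a) \<cdot>\<^bsub>C\<^esub> comult W a = Ident C (fob (cfun W) a) \<and>
        comult W (fob (cfun W) a) \<cdot>\<^bsub>C\<^esub> comult W a =
          farr (cfun W) (comult W a) \<cdot>\<^bsub>C\<^esub> comult W a)"

definition coalgebra :: "('o, 'm) cat \<Rightarrow> ('o, 'm) cmnd \<Rightarrow> 'o \<times> 'm \<Rightarrow> bool" where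
  "coalgebra C W = (\<lambda>(A, \<alpha>). A \<in> Ob C \<and> \<alpha> \<in> hom C A (fob (cfun W) A) \<and>
     counit W A \<cdot>\<^bsub>C\<^esub> \<alpha> = Ident C A \<and>
     comult W A \<cdot>\<^bsub>C\<^esub> \<alpha> = farr (cfun W) \<alpha> \<cdot>\<^bsub>C\<^esub> \<alpha>)"

definition coalgebra_morphism ::
  "('o, 'm) cat \<Rightarrow> ('o, 'm) cmnd \<Rightarrow> 'o \<times> 'm \<Rightarrow> 'm \<Rightarrow> 'o \<times> 'm \<Rightarrow> bool" where
  "coalgebra_morphism C W = (\<lambda>(A, \<alpha>) f (B, \<beta>).
     coalgebra C W (A, \<alpha>) \<and> coalgebra C W (B, \<beta>) \<and> f \<in> hom C A B \<and>
     \<beta> \<cdot>\<^bsub>C\<^esub> f = farr (cfun W) f \<cdot>\<^bsub>C\<^esub> \<alpha>)"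

text \<open>An arrow of \<open>EM C W\<close> is a triple of source coalgebra, underlying morphism and target
  coalgebra.\<close>

definition EM ::
  "('o, 'm) cat \<Rightarrow> ('o, 'm) cmnd \<Rightarrow> ('o \<times> 'm, ('o \<times> 'm) \<times> 'm \<times> ('o \<times> 'm)) cat" where
  "EM C W =
     \<lparr>Ob = {X. coalgebra C W X},
      Arr = {(X, f, Y). coalgebra_morphism C W X f Y},
      Dom = \<lambda>(X, f, Y). X,
      Cod = \<lambda>(X, f, Y). Y,
      Ident = \<lambda>X. (X, Ident C (fst X), X),
      Comp = \<lambda>(Y', g, Z) (X, f, Y). (X, g \<cdot>\<^bsub>C\<^esub> f, Z)\<rparr>"

definition EM_lift ::
  "('o, 'm) cat \<Rightarrow> ('o, 'm) cmnd \<Rightarrow> 'm set \<Rightarrow> (('o \<times> 'm) \<times> 'm \<times> ('o \<times> 'm)) set" where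
  "EM_lift C W K = {(X, f, Y). (X, f, Y) \<in> Arr (EM C W) \<and> f \<in> K}"

definition cofree :: "('o, 'm) cmnd \<Rightarrow> 'o \<Rightarrow> 'o \<times> 'm" where
  "cofree W A = (fob (cfun W) A, comult W A)"

text \<open>The relation \<open>A \<rightarrow>\<^sup>e B\<close>, for the class \<open>M\<close> of embeddings of \<open>C\<close> and the class \<open>P\<close> of paths
  of \<open>EM C W\<close>.\<close>

definition arrow_e ::
  "('o, 'm) cat \<Rightarrow> ('o, 'm) cmnd \<Rightarrow> 'm set \<Rightarrow> ('o \<times> 'm) set \<Rightarrow> 'o \<Rightarrow> 'o \<Rightarrow> bool" where
  "arrow_e C W M P A B \<longleftrightarrow>
     (\<exists>f \<in> hom (EM C W) (cofree W A) (cofree W B). pathwise_embedding (EM C W) (EM_lift C W M) P f)"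

section \<open>Kleisli laws and bimorphisms\<close>

definition kleisli_law ::
  "('i \<Rightarrow> ('o, 'm) cat) \<Rightarrow> ('i \<Rightarrow> ('o, 'm) cmnd) \<Rightarrow> ('p, 'n) cat \<Rightarrow> ('p, 'n) cmnd \<Rightarrow>
   ('i \<Rightarrow> 'o, 'i \<Rightarrow> 'm, 'p, 'n) fnctr \<Rightarrow> (('i \<Rightarrow> 'o) \<Rightarrow> 'n) \<Rightarrow> bool" where
  "kleisli_law C W D V H \<kappa> \<longleftrightarrow>
     nat_trans (prod_cat C) D (comp_fun (cfun V) H) (comp_fun H (prod_fun (\<lambda>i. cfun (W i)))) \<kappa> \<and>
     (\<forall>A \<in> Ob (prod_cat C).
        farr H (\<lambda>i. counit (W i) (A i)) \<cdot>\<^bsub>D\<^esub> \<kappa> A = counit V (fob H A) \<and>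
        farr H (\<lambda>i. comult (W i) (A i)) \<cdot>\<^bsub>D\<^esub> \<kappa> A =
          \<kappa> (\<lambda>i. fob (cfun (W i)) (A i)) \<cdot>\<^bsub>D\<^esub> farr (cfun V) (\<kappa> A) \<cdot>\<^bsub>D\<^esub> comult V (fob H A))"

definition bimorphism ::
  "('i \<Rightarrow> ('o, 'm) cat) \<Rightarrow> ('i \<Rightarrow> ('o, 'm) cmnd) \<Rightarrow> ('p, 'n) cat \<Rightarrow> ('p, 'n) cmnd \<Rightarrow>
   ('i \<Rightarrow> 'o, 'i \<Rightarrow> 'm, 'p, 'n) fnctr \<Rightarrow> (('i \<Rightarrow> 'o) \<Rightarrow> 'n) \<Rightarrow>
   'p \<times> 'n \<Rightarrow> ('i \<Rightarrow> 'o \<times> 'm) \<Rightarrow> 'n \<Rightarrow> bool" where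
  "bimorphism C W D V H \<kappa> = (\<lambda>(A, \<alpha>) Y g.
     coalgebra D V (A, \<alpha>) \<and> (\<forall>i. coalgebra (C i) (W i) (Y i)) \<and>
     g \<in> hom D A (fob H (\<lambda>i. fst (Y i))) \<and>
     farr H (\<lambda>i. snd (Y i)) \<cdot>\<^bsub>D\<^esub> g =
       \<kappa> (\<lambda>i. fst (Y i)) \<cdot>\<^bsub>D\<^esub> farr (cfun V) g \<cdot>\<^bsub>D\<^esub> \<alpha>)"

text \<open>Condition (S2''): here \<open>R i\<close> is the path coalgebra \<open>(P\<^sub>i, \<pi>\<^sub>i)\<close>, \<open>M i\<close> is the class of
  embeddings of \<open>C i\<close>, and \<open>P i\<close> and \<open>Q\<close> are the classes of paths of \<open>EM (C i) (W i)\<close> and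
  \<open>EM D V\<close>. Note that \<open>f\<^sub>0\<close> is only asked to be a morphism of \<open>D\<close>.\<close>

definition S2'' ::
  "('i \<Rightarrow> ('o, 'm) cat) \<Rightarrow> ('i \<Rightarrow> ('o, 'm) cmnd) \<Rightarrow> ('i \<Rightarrow> 'm set) \<Rightarrow> ('i \<Rightarrow> ('o \<times> 'm) set) \<Rightarrow>
   ('p, 'n) cat \<Rightarrow> ('p, 'n) cmnd \<Rightarrow> ('p \<times> 'n) set \<Rightarrow>
   ('i \<Rightarrow> 'o, 'i \<Rightarrow> 'm, 'p, 'n) fnctr \<Rightarrow> (('i \<Rightarrow> 'o) \<Rightarrow> 'n) \<Rightarrow> bool" where
  "S2'' C W M P D V Q H \<kappa> \<longleftrightarrow>
     (\<forall>p \<in> Q. \<forall>Y f. (\<forall>i. Y i \<in> Ob (EM (C i) (W i))) \<longrightarrow> bimorphism C W D V H \<kappa> p Y f \<longrightarrow>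
        (\<exists>R e f\<^sub>0.
           (\<forall>i. path_embedding (EM (C i) (W i)) (EM_lift (C i) (W i) (M i)) (P i) (R i, e i, Y i)) \<and>
           f\<^sub>0 \<in> hom D (fst p) (fob H (\<lambda>i. fst (R i))) \<and>
           f = farr H e \<cdot>\<^bsub>D\<^esub> f\<^sub>0))"

end

theory Submission
  imports Defs
begin

text \<open>
  Since \<open>F(HA)\<close> is the lift of \<open>H\<close> at the cofree coalgebras \<open>F(A\<^sub>i)\<close>, the lift of \<open>H\<close> to the
  Eilenberg--Moore categories is only needed on morphisms between cofree coalgebras, where it is
  given by an explicit formula. Pathwise-embeddings \<open>f\<^sub>i : F(A\<^sub>i) \<rightarrow> F(B\<^sub>i)\<close> are sent
  to the coalgebra morphism \<open>h : F(HA) \<rightarrow> F(HB)\<close> that corresponds to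
  \<open>H(\<epsilon>\<^sub>B) \<circ> H(f) \<circ> \<kappa>\<^sub>A\<close>; the Kleisli law gives \<open>\<kappa>\<^sub>B \<circ> h = H(f) \<circ> \<kappa>\<^sub>A\<close>.
  For a path embedding \<open>e : (P, \<pi>) \<rightarrow> F(HA)\<close>, the bimorphism \<open>\<kappa>\<^sub>A \<circ> e\<close> decomposes as
  \<open>H(e\<^sub>1, \<dots>, e\<^sub>n) \<circ> f\<^sub>0\<close>. As \<open>\<DD>(\<kappa>\<^sub>A) \<circ> \<delta>\<close> is split by \<open>\<DD>(H(\<epsilon>\<^sub>A))\<close>, it is an embedding, hence so is
  \<open>\<DD>(\<kappa>\<^sub>A) \<circ> \<delta> \<circ> e = \<DD>(H(e\<^sub>i)) \<circ> \<DD>(f\<^sub>0) \<circ> \<pi>\<close>, and so \<open>\<DD>(f\<^sub>0) \<circ> \<pi>\<close> is one. Then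
  \<open>\<DD>(\<kappa>\<^sub>B) \<circ> \<delta> \<circ> h \<circ> e = \<DD>(H(f\<^sub>i \<circ> e\<^sub>i)) \<circ> \<DD>(f\<^sub>0) \<circ> \<pi>\<close> is an embedding, and therefore \<open>h \<circ> e\<close> is.
\<close>

section \<open>Typed laws of categories, functors, natural transformations and finite
  products\<close>

lemma hom_Arr: "f \<in> hom C a b \<Longrightarrow> f \<in> Arr C"
  and hom_Dom: "f \<in> hom C a b \<Longrightarrow> Dom C f = a"
  and hom_Cod: "f \<in> hom C a b \<Longrightarrow> Cod C f = b"
  by (auto simp: hom_def)

lemma comp_hom:
  assumes "category C" "g \<in> hom C b c" "f \<in> hom C a b"
  shows "g \<cdot>\<^bsub>C\<^esub> f \<in> hom C a c"
proof -
  have "\<forall>f \<in> Arr C. \<forall>g \<in> Arr C. Cod C f = Dom C g \<longrightarrow> g \<cdot>\<^bsub>C\<^esub> f \<in> hom C (Dom C f) (Cod C g)"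
    using assms(1) unfolding category_def by (elim conjE) assumption
  then show ?thesis
    using assms(2,3) by (simp add: hom_def)
qed

lemma comp_assoc:
  assumes "category C" "h \<in> hom C c d" "g \<in> hom C b c" "f \<in> hom C a b"
  shows "(h \<cdot>\<^bsub>C\<^esub> g) \<cdot>\<^bsub>C\<^esub> f = h \<cdot>\<^bsub>C\<^esub> (g \<cdot>\<^bsub>C\<^esub> f)"
proof -
  have "\<forall>f \<in> Arr C. \<forall>g \<in> Arr C. \<forall>h \<in> Arr C. Cod C f = Dom C g \<longrightarrow> Cod C g = Dom C h \<longrightarrow>
      h \<cdot>\<^bsub>C\<^esub> (g \<cdot>\<^bsub>C\<^esub> f) = (h \<cdot>\<^bsub>C\<^esub> g) \<cdot>\<^bsub>C\<^esub> f"
    using assms(1) unfolding category_def by (elim conjE) assumption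
  then show ?thesis
    using assms(2-4) by (simp add: hom_def)
qed

lemma Ident_hom: "category C \<Longrightarrow> a \<in> Ob C \<Longrightarrow> Ident C a \<in> hom C a a"
  unfolding category_def by blast

lemma comp_Ident_left: "category C \<Longrightarrow> f \<in> hom C a b \<Longrightarrow> Ident C b \<cdot>\<^bsub>C\<^esub> f = f"
  unfolding category_def hom_def by blast

lemma hom_Ob:
  assumes "category C" "f \<in> hom C a b"
  shows "a \<in> Ob C" "b \<in> Ob C"
  using assms unfolding category_def hom_def by blast+

lemma functor_ob: "is_functor C D F \<Longrightarrow> a \<in> Ob C \<Longrightarrow> fob F a \<in> Ob D"
  unfolding is_functor_def by blast

lemma functor_hom: "is_functor C D F \<Longrightarrow> f \<in> hom C a b \<Longrightarrow> farr F f \<in> hom D (fob F a) (fob F b)"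
  unfolding is_functor_def hom_def by blast

lemma functor_comp:
  assumes "is_functor C D F" "g \<in> hom C b c" "f \<in> hom C a b"
  shows "farr F (g \<cdot>\<^bsub>C\<^esub> f) = farr F g \<cdot>\<^bsub>D\<^esub> farr F f"
proof -
  have "\<forall>f \<in> Arr C. \<forall>g \<in> Arr C. Cod C f = Dom C g \<longrightarrow>
      farr F (g \<cdot>\<^bsub>C\<^esub> f) = farr F g \<cdot>\<^bsub>D\<^esub> farr F f"
    using assms(1) unfolding is_functor_def by (elim conjE) assumption
  then show ?thesis
    using assms(2,3) by (simp add: hom_def)
qed

lemma functor_Ident: "is_functor C D F \<Longrightarrow> a \<in> Ob C \<Longrightarrow> farr F (Ident C a) = Ident D (fob F a)"
  unfolding is_functor_def by blast

lemma nat_trans_hom: "nat_trans C D F G \<tau> \<Longrightarrow> a \<in> Ob C \<Longrightarrow> \<tau> a \<in> hom D (fob F a) (fob G a)"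
  unfolding nat_trans_def by blast

lemma nat_trans_naturality:
  "nat_trans C D F G \<tau> \<Longrightarrow> f \<in> hom C a b \<Longrightarrow> \<tau> b \<cdot>\<^bsub>D\<^esub> farr F f = farr G f \<cdot>\<^bsub>D\<^esub> \<tau> a"
  unfolding nat_trans_def hom_def by blast

lemma prod_cat_Ob: "A \<in> Ob (prod_cat C) \<longleftrightarrow> (\<forall>i. A i \<in> Ob (C i))"
  by (simp add: prod_cat_def)

lemma prod_cat_hom: "f \<in> hom (prod_cat C) A B \<longleftrightarrow> (\<forall>i. f i \<in> hom (C i) (A i) (B i))"
  by (auto simp: prod_cat_def hom_def fun_eq_iff)

lemma prod_cat_Comp: "Comp (prod_cat C) g f = (\<lambda>i. g i \<cdot>\<^bsub>C i\<^esub> f i)"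
  by (simp add: prod_cat_def)

lemma prod_cat_Ident: "Ident (prod_cat C) A = (\<lambda>i. Ident (C i) (A i))"
  by (simp add: prod_cat_def)

section \<open>Comonads, their coalgebras and the Eilenberg-Moore category\<close>

lemma comonad_functor: "comonad C W \<Longrightarrow> is_functor C C (cfun W)"
  unfolding comonad_def nat_trans_def by blast

lemma comonad_category: "comonad C W \<Longrightarrow> category C"
  using comonad_functor unfolding is_functor_def by blast

lemma counit_hom: "comonad C W \<Longrightarrow> a \<in> Ob C \<Longrightarrow> counit W a \<in> hom C (fob (cfun W) a) a"
  unfolding comonad_def using nat_trans_hom[of C C "cfun W" id_fun] by (fastforce simp: id_fun_def)

lemma comult_hom:
  "comonad C W \<Longrightarrow> a \<in> Ob C \<Longrightarrow> comult W a \<in> hom C (fob (cfun W) a) (fob (cfun W) (fob (cfun W) a))"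
  unfolding comonad_def
  using nat_trans_hom[of C C "cfun W" "comp_fun (cfun W) (cfun W)"] by (fastforce simp: comp_fun_def)

lemma comult_naturality:
  assumes "comonad C W" "f \<in> hom C a b"
  shows "comult W b \<cdot>\<^bsub>C\<^esub> farr (cfun W) f = farr (cfun W) (farr (cfun W) f) \<cdot>\<^bsub>C\<^esub> comult W a"
  using assms nat_trans_naturality[of C C "cfun W" "comp_fun (cfun W) (cfun W)"]
  unfolding comonad_def by (fastforce simp: comp_fun_def)

lemma coalgebra_cofree:
  assumes "comonad C W" "a \<in> Ob C"
  shows "coalgebra C W (cofree W a)"
  using assms comult_hom[OF assms] functor_ob[OF comonad_functor[OF assms(1)] assms(2)]
  unfolding coalgebra_def cofree_def comonad_def by simp

text \<open>This is the transpose of \<open>g\<close> under the adjunction between the forgetful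
  functor and the cofree functor. Naturality of the comultiplication moves it past
  \<open>farr (cfun V) g\<close>, and coassociativity of \<open>\<alpha>\<close> does the
  rest.\<close>

lemma coalgebra_morphism_coextension:
  assumes V: "comonad D V" and \<alpha>: "coalgebra D V (X, \<alpha>)" and g: "g \<in> hom D X Y"
  shows "coalgebra_morphism D V (X, \<alpha>) (farr (cfun V) g \<cdot>\<^bsub>D\<^esub> \<alpha>) (cofree V Y)"
proof -
  note cat = comonad_category[OF V] and F = comonad_functor[OF V]
  have Y: "Y \<in> Ob D" using hom_Ob[OF cat g] by simp
  have a: "\<alpha> \<in> hom D X (fob (cfun V) X)"
    and coassoc: "comult V X \<cdot>\<^bsub>D\<^esub> \<alpha> = farr (cfun V) \<alpha> \<cdot>\<^bsub>D\<^esub> \<alpha>" and X: "X \<in> Ob D"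
    using \<alpha> by (auto simp: coalgebra_def)
  note Vg = functor_hom[OF F g]
  note dX = comult_hom[OF V X] and dY = comult_hom[OF V Y]
  have "comult V Y \<cdot>\<^bsub>D\<^esub> (farr (cfun V) g \<cdot>\<^bsub>D\<^esub> \<alpha>)
      = (farr (cfun V) (farr (cfun V) g) \<cdot>\<^bsub>D\<^esub> comult V X) \<cdot>\<^bsub>D\<^esub> \<alpha>"
    by (metis comp_assoc[OF cat dY Vg a] comult_naturality[OF V g])
  also have "\<dots> = farr (cfun V) (farr (cfun V) g) \<cdot>\<^bsub>D\<^esub> (farr (cfun V) \<alpha> \<cdot>\<^bsub>D\<^esub> \<alpha>)"
    by (metis comp_assoc[OF cat functor_hom[OF F Vg] dX a] coassoc)
  also have "\<dots> = farr (cfun V) (farr (cfun V) g \<cdot>\<^bsub>D\<^esub> \<alpha>) \<cdot>\<^bsub>D\<^esub> \<alpha>"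
    by (metis comp_assoc[OF cat functor_hom[OF F Vg] functor_hom[OF F a] a] functor_comp[OF F Vg a])
  finally show ?thesis
    using \<alpha> coalgebra_cofree[OF V Y] comp_hom[OF cat Vg a]
    by (simp add: coalgebra_morphism_def cofree_def)
qed

lemma EM_hom: "F \<in> hom (EM C W) X Y \<longleftrightarrow> (\<exists>f. F = (X, f, Y) \<and> coalgebra_morphism C W X f Y)"
  by (auto simp: EM_def hom_def)

lemma EM_Dom: "Dom (EM C W) (X, f, Y) = X"
  and EM_Cod: "Cod (EM C W) (X, f, Y) = Y"
  and EM_Comp: "Comp (EM C W) (Z, g, U) (X, f, Y) = (X, g \<cdot>\<^bsub>C\<^esub> f, U)"
  and EM_Ob: "X \<in> Ob (EM C W) \<longleftrightarrow> coalgebra C W X"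
  and EM_Arr: "(X, f, Y) \<in> Arr (EM C W) \<longleftrightarrow> coalgebra_morphism C W X f Y"
  by (simp_all add: EM_def)

lemma EM_lift_iff: "(X, f, Y) \<in> EM_lift C W K \<longleftrightarrow> coalgebra_morphism C W X f Y \<and> f \<in> K"
  by (simp add: EM_lift_def EM_Arr)

lemma coalgebra_morphism_hom:
  "coalgebra_morphism C W X f Y \<Longrightarrow> f \<in> hom C (fst X) (fst Y)"
  by (auto simp: coalgebra_morphism_def split: prod.splits)

lemma coalgebra_morphism_commutes:
  "coalgebra_morphism C W X f Y \<Longrightarrow> snd Y \<cdot>\<^bsub>C\<^esub> f = farr (cfun W) f \<cdot>\<^bsub>C\<^esub> snd X"
  by (auto simp: coalgebra_morphism_def split: prod.splits)

lemma coalgebra_morphism_coalgebra: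
  assumes "coalgebra_morphism C W X f Y"
  shows "coalgebra C W X" "coalgebra C W Y"
  using assms by (auto simp: coalgebra_morphism_def split: prod.splits)

lemma coalgebra_morphism_comp:
  assumes W: "comonad C W" and f: "coalgebra_morphism C W X f Y" and g: "coalgebra_morphism C W Y g Z"
  shows "coalgebra_morphism C W X (g \<cdot>\<^bsub>C\<^esub> f) Z"
proof -
  obtain A \<alpha> B \<beta> U \<gamma> where XYZ: "X = (A, \<alpha>)" "Y = (B, \<beta>)" "Z = (U, \<gamma>)"
    by (metis surj_pair)
  note cat = comonad_category[OF W] and F = comonad_functor[OF W]
  have fh: "f \<in> hom C A B" and gh: "g \<in> hom C B U"
    and a: "\<alpha> \<in> hom C A (fob (cfun W) A)" and b: "\<beta> \<in> hom C B (fob (cfun W) B)"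
    and c: "\<gamma> \<in> hom C U (fob (cfun W) U)"
    and ef: "\<beta> \<cdot>\<^bsub>C\<^esub> f = farr (cfun W) f \<cdot>\<^bsub>C\<^esub> \<alpha>" and eg: "\<gamma> \<cdot>\<^bsub>C\<^esub> g = farr (cfun W) g \<cdot>\<^bsub>C\<^esub> \<beta>"
    and cA: "coalgebra C W X" and cU: "coalgebra C W Z"
    using f g by (auto simp: XYZ coalgebra_morphism_def coalgebra_def)
  note Wf = functor_hom[OF F fh] and Wg = functor_hom[OF F gh]
  have "\<gamma> \<cdot>\<^bsub>C\<^esub> (g \<cdot>\<^bsub>C\<^esub> f) = farr (cfun W) g \<cdot>\<^bsub>C\<^esub> (\<beta> \<cdot>\<^bsub>C\<^esub> f)"
    by (metis comp_assoc[OF cat c gh fh] eg comp_assoc[OF cat Wg b fh])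
  also have "\<dots> = farr (cfun W) (g \<cdot>\<^bsub>C\<^esub> f) \<cdot>\<^bsub>C\<^esub> \<alpha>"
    by (metis ef comp_assoc[OF cat Wg Wf a] functor_comp[OF F gh fh])
  finally show ?thesis
    using cA cU comp_hom[OF cat gh fh] by (simp add: XYZ coalgebra_morphism_def)
qed

section \<open>Closure properties of the embeddings of a proper factorisation system\<close>

lemma factorisation_category: "proper_factorisation_system C E M \<Longrightarrow> category C"
  unfolding proper_factorisation_system_def by (elim conjE)

lemma quotient_epic: "proper_factorisation_system C E M \<Longrightarrow> e \<in> E \<Longrightarrow> epic C e"
  unfolding proper_factorisation_system_def by (elim conjE) (erule bspec)

lemma embedding_iff:
  assumes "proper_factorisation_system C E M"
  shows "m \<in> M \<longleftrightarrow> m \<in> Arr C \<and> (\<forall>e \<in> E. weakly_orthogonal C e m)"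
proof -
  have "M = {m \<in> Arr C. \<forall>e \<in> E. weakly_orthogonal C e m}"
    using assms unfolding proper_factorisation_system_def by (elim conjE) assumption
  then show ?thesis by (rule ssubst) simp
qed

text \<open>Composing a square against \<open>f\<close> with \<open>g\<close> gives a square against
  the composite, whose diagonal \<open>d\<close> already satisfies the upper triangle. The lower
  triangle for \<open>f\<close> holds after precomposition with \<open>e\<close>, hence outright,
  because quotients are epic.\<close>

lemma embedding_cancel:
  assumes pfs: "proper_factorisation_system C E M"
    and f: "f \<in> hom C a b" and g: "g \<in> hom C b c" and gf: "g \<cdot>\<^bsub>C\<^esub> f \<in> M"
  shows "f \<in> M"
proof -
  note cat = factorisation_category[OF pfs] and M_iff = embedding_iff[OF pfs]
  have "weakly_orthogonal C e f" if "e \<in> E" for e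
    unfolding weakly_orthogonal_def
  proof (intro ballI impI)
    fix u v assume "u \<in> hom C (Dom C e) (Dom C f)" "v \<in> hom C (Cod C e) (Cod C f)"
      and sq: "v \<cdot>\<^bsub>C\<^esub> e = f \<cdot>\<^bsub>C\<^esub> u"
    then have u: "u \<in> hom C (Dom C e) a" and v: "v \<in> hom C (Cod C e) b"
      using hom_Dom[OF f] hom_Cod[OF f] by simp_all
    have ep: "epic C e" using quotient_epic[OF pfs that] .
    then have e: "e \<in> hom C (Dom C e) (Cod C e)" by (simp add: epic_def hom_def)
    have "weakly_orthogonal C e (g \<cdot>\<^bsub>C\<^esub> f)" using gf that by (simp add: M_iff)
    moreover have "(g \<cdot>\<^bsub>C\<^esub> v) \<cdot>\<^bsub>C\<^esub> e = (g \<cdot>\<^bsub>C\<^esub> f) \<cdot>\<^bsub>C\<^esub> u"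
      by (simp add: comp_assoc[OF cat g v e] comp_assoc[OF cat g f u] sq)
    moreover note gfh = comp_hom[OF cat g f] and gvh = comp_hom[OF cat g v]
    ultimately obtain d where d: "d \<in> hom C (Cod C e) a" and de: "d \<cdot>\<^bsub>C\<^esub> e = u"
      unfolding weakly_orthogonal_def using u hom_Dom[OF gfh] hom_Cod[OF gfh] by metis
    have fd: "f \<cdot>\<^bsub>C\<^esub> d \<in> hom C (Cod C e) b" by (rule comp_hom[OF cat f d])
    have "(f \<cdot>\<^bsub>C\<^esub> d) \<cdot>\<^bsub>C\<^esub> e = v \<cdot>\<^bsub>C\<^esub> e"
      by (simp add: comp_assoc[OF cat f d e] de sq)
    then have "f \<cdot>\<^bsub>C\<^esub> d = v"
      using ep hom_Arr[OF fd] hom_Dom[OF fd] hom_Arr[OF v] hom_Dom[OF v] by (simp add: epic_def)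
    then show "\<exists>d \<in> hom C (Cod C e) (Dom C f). d \<cdot>\<^bsub>C\<^esub> e = u \<and> f \<cdot>\<^bsub>C\<^esub> d = v"
      using d de hom_Dom[OF f] by auto
  qed
  then show ?thesis using hom_Arr[OF f] by (simp add: M_iff)
qed

text \<open>Lifts are taken twice: a diagonal against \<open>g\<close> for the square with edge
  \<open>f\<close> after \<open>u\<close>, and then a diagonal against \<open>f\<close> for the
  square in which the first diagonal replaces \<open>v\<close>.\<close>

lemma embedding_comp:
  assumes pfs: "proper_factorisation_system C E M"
    and f: "f \<in> hom C a b" "f \<in> M" and g: "g \<in> hom C b c" "g \<in> M"
  shows "g \<cdot>\<^bsub>C\<^esub> f \<in> M"
proof -
  note cat = factorisation_category[OF pfs] and M_iff = embedding_iff[OF pfs]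
  note gf = comp_hom[OF cat g(1) f(1)]
  have "weakly_orthogonal C e (g \<cdot>\<^bsub>C\<^esub> f)" if eE: "e \<in> E" for e
    unfolding weakly_orthogonal_def
  proof (intro ballI impI)
    fix u v assume "u \<in> hom C (Dom C e) (Dom C (g \<cdot>\<^bsub>C\<^esub> f))" "v \<in> hom C (Cod C e) (Cod C (g \<cdot>\<^bsub>C\<^esub> f))"
      and "v \<cdot>\<^bsub>C\<^esub> e = (g \<cdot>\<^bsub>C\<^esub> f) \<cdot>\<^bsub>C\<^esub> u"
    then have u: "u \<in> hom C (Dom C e) a" and v: "v \<in> hom C (Cod C e) c"
      and sq: "v \<cdot>\<^bsub>C\<^esub> e = g \<cdot>\<^bsub>C\<^esub> (f \<cdot>\<^bsub>C\<^esub> u)"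
      using hom_Dom[OF gf] hom_Cod[OF gf] comp_assoc[OF cat g(1) f(1)] by metis+
    have "weakly_orthogonal C e g" "weakly_orthogonal C e f" using f g eE by (simp_all add: M_iff)
    then obtain d where d: "d \<in> hom C (Cod C e) b" "d \<cdot>\<^bsub>C\<^esub> e = f \<cdot>\<^bsub>C\<^esub> u" "g \<cdot>\<^bsub>C\<^esub> d = v"
      unfolding weakly_orthogonal_def
      using sq v comp_hom[OF cat f(1) u] hom_Dom[OF g(1)] hom_Cod[OF g(1)] by metis
    then obtain d' where d': "d' \<in> hom C (Cod C e) a" "d' \<cdot>\<^bsub>C\<^esub> e = u" "f \<cdot>\<^bsub>C\<^esub> d' = d"
      using \<open>weakly_orthogonal C e f\<close> unfolding weakly_orthogonal_def
      using u hom_Dom[OF f(1)] hom_Cod[OF f(1)] by metis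
    then have "(g \<cdot>\<^bsub>C\<^esub> f) \<cdot>\<^bsub>C\<^esub> d' = v"
      using d comp_assoc[OF cat g(1) f(1) d'(1)] by simp
    then show "\<exists>d \<in> hom C (Cod C e) (Dom C (g \<cdot>\<^bsub>C\<^esub> f)). d \<cdot>\<^bsub>C\<^esub> e = u \<and> (g \<cdot>\<^bsub>C\<^esub> f) \<cdot>\<^bsub>C\<^esub> d = v"
      using d' hom_Dom[OF gf] by auto
  qed
  then show ?thesis using hom_Arr[OF gf] by (simp add: M_iff)
qed

text \<open>The edge \<open>v\<close> of the square serves as its own diagonal.\<close>

lemma Ident_embedding:
  assumes pfs: "proper_factorisation_system C E M" and a: "a \<in> Ob C"
  shows "Ident C a \<in> M"
proof -
  note cat = factorisation_category[OF pfs] and M_iff = embedding_iff[OF pfs]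
  note i = Ident_hom[OF cat a]
  have "weakly_orthogonal C e (Ident C a)" for e
    unfolding weakly_orthogonal_def
    by (metis comp_Ident_left[OF cat] hom_Cod[OF i] hom_Dom[OF i])
  then show ?thesis using hom_Arr[OF i] by (simp add: M_iff)
qed

text \<open>Cancellation applies because the composite with the retraction is an identity. This is
  how \<open>\<kappa>_ext\<close> is recognised as an embedding without any such knowledge about
  \<kappa> itself.\<close>

lemma split_mono_embedding:
  assumes pfs: "proper_factorisation_system C E M"
    and "s \<in> hom C a b" "r \<in> hom C b a" "r \<cdot>\<^bsub>C\<^esub> s = Ident C a"
  shows "s \<in> M"
proof -
  have "a \<in> Ob C" using hom_Ob[OF factorisation_category[OF pfs] assms(2)] by simp
  then have "r \<cdot>\<^bsub>C\<^esub> s \<in> M" using Ident_embedding[OF pfs] assms(4) by simp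
  then show ?thesis by (rule embedding_cancel[OF pfs assms(2,3)])
qed

section \<open>Calculus of a Kleisli law and of its transposed components\<close>

locale kleisli =
  fixes C :: "'i \<Rightarrow> ('o, 'm) cat" and W :: "'i \<Rightarrow> ('o, 'm) cmnd"
    and D :: "('p, 'n) cat" and V :: "('p, 'n) cmnd"
    and H :: "('i \<Rightarrow> 'o, 'i \<Rightarrow> 'm, 'p, 'n) fnctr" and \<kappa> :: "('i \<Rightarrow> 'o) \<Rightarrow> 'n"
  assumes W: "\<And>i. comonad (C i) (W i)" and V: "comonad D V"
    and H: "is_functor (prod_cat C) D H" and law: "kleisli_law C W D V H \<kappa>"
begin

abbreviation "WO X \<equiv> (\<lambda>i. fob (cfun (W i)) (X i))"
abbreviation "WA f \<equiv> (\<lambda>i. farr (cfun (W i)) (f i))"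
abbreviation "VO \<equiv> fob (cfun V)"
abbreviation "VA \<equiv> farr (cfun V)"
abbreviation comp (infixr "\<bullet>" 70) where "g \<bullet> f \<equiv> g \<cdot>\<^bsub>D\<^esub> f"

lemmas cat = comonad_category[OF V]
lemmas VF = comonad_functor[OF V]
lemmas VA_hom = functor_hom[OF VF]
lemmas VA_comp = functor_comp[OF VF]
lemmas D_hom = comp_hom[OF cat]
lemmas D_assoc = comp_assoc[OF cat]

lemma H_ob: "(\<And>i. X i \<in> Ob (C i)) \<Longrightarrow> fob H X \<in> Ob D"
  using functor_ob[OF H] by (simp add: prod_cat_Ob)

lemma H_hom: "(\<And>i. f i \<in> hom (C i) (X i) (Y i)) \<Longrightarrow> farr H f \<in> hom D (fob H X) (fob H Y)"
  using functor_hom[OF H] by (simp add: prod_cat_hom)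

lemma H_comp:
  assumes "\<And>i. g i \<in> hom (C i) (Y i) (Z i)" "\<And>i. f i \<in> hom (C i) (X i) (Y i)"
  shows "farr H (\<lambda>i. g i \<cdot>\<^bsub>C i\<^esub> f i) = farr H g \<bullet> farr H f"
  using functor_comp[OF H, of g Y Z f X] assms by (simp add: prod_cat_hom prod_cat_Comp)

lemma WO_ob: "(\<And>i. X i \<in> Ob (C i)) \<Longrightarrow> WO X i \<in> Ob (C i)"
  using functor_ob[OF comonad_functor[OF W]] by blast

lemma \<kappa>_hom: "(\<And>i. X i \<in> Ob (C i)) \<Longrightarrow> \<kappa> X \<in> hom D (VO (fob H X)) (fob H (WO X))"
  using law nat_trans_hom[of "prod_cat C" D _ _ \<kappa> X] unfolding kleisli_law_def
  by (fastforce simp: comp_fun_def prod_fun_def prod_cat_Ob)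

lemma \<kappa>_naturality:
  assumes "\<And>i. f i \<in> hom (C i) (X i) (Y i)"
  shows "\<kappa> Y \<bullet> VA (farr H f) = farr H (WA f) \<bullet> \<kappa> X"
  using law assms nat_trans_naturality[of "prod_cat C" D _ _ \<kappa> f X Y] unfolding kleisli_law_def
  by (fastforce simp: comp_fun_def prod_fun_def prod_cat_hom)

lemma \<kappa>_counit:
  "(\<And>i. X i \<in> Ob (C i)) \<Longrightarrow> farr H (\<lambda>i. counit (W i) (X i)) \<bullet> \<kappa> X = counit V (fob H X)"
  using law unfolding kleisli_law_def by (simp add: prod_cat_Ob)

lemma \<kappa>_comult:
  "(\<And>i. X i \<in> Ob (C i)) \<Longrightarrow> farr H (\<lambda>i. comult (W i) (X i)) \<bullet> \<kappa> X
     = \<kappa> (WO X) \<bullet> VA (\<kappa> X) \<bullet> comult V (fob H X)"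
  using law unfolding kleisli_law_def by (simp add: prod_cat_Ob)

lemma counit_W_hom: "(\<And>i. X i \<in> Ob (C i)) \<Longrightarrow> counit (W i) (X i) \<in> hom (C i) (WO X i) (X i)"
  using counit_hom[OF W] by blast

text \<open>The transpose of \<open>\<kappa> X\<close>, that is, the coalgebra morphism from the
  cofree coalgebra on \<open>fob H X\<close> to the one on \<open>fob H (WO X)\<close>. In these
  terms the comultiplication axiom says that H(\<delta>) after \<open>\<kappa> X\<close> equals
  \<open>\<kappa> (WO X)\<close> after \<open>\<kappa>_ext X\<close>.\<close>

definition \<kappa>_ext :: "('i \<Rightarrow> 'o) \<Rightarrow> 'n" where
  "\<kappa>_ext X = VA (\<kappa> X) \<bullet> comult V (fob H X)"

lemma \<kappa>_ext_hom:
  assumes "\<And>i. X i \<in> Ob (C i)"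
  shows "\<kappa>_ext X \<in> hom D (VO (fob H X)) (VO (fob H (WO X)))"
  unfolding \<kappa>_ext_def
  by (rule D_hom[OF VA_hom[OF \<kappa>_hom[of X]] comult_hom[OF V H_ob[of X]]]) (use assms in blast)+

text \<open>The counit axiom of the Kleisli law merges the two images under V into that of the
  counit of V, and the comonad law V(\<epsilon>) after \<delta> finishes.\<close>

lemma \<kappa>_ext_split:
  assumes X: "\<And>i. X i \<in> Ob (C i)"
  shows "VA (farr H (\<lambda>i. counit (W i) (X i))) \<bullet> \<kappa>_ext X = Ident D (VO (fob H X))"
proof -
  have e: "farr H (\<lambda>i. counit (W i) (X i)) \<in> hom D (fob H (WO X)) (fob H X)"
    using counit_hom[OF W] X by (intro H_hom) blast
  have k: "\<kappa> X \<in> hom D (VO (fob H X)) (fob H (WO X))" using \<kappa>_hom X by blast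
  have HX: "fob H X \<in> Ob D" using H_ob X by blast
  have "VA (farr H (\<lambda>i. counit (W i) (X i))) \<bullet> \<kappa>_ext X
      = VA (farr H (\<lambda>i. counit (W i) (X i)) \<bullet> \<kappa> X) \<bullet> comult V (fob H X)"
    unfolding \<kappa>_ext_def
    by (simp add: VA_comp[OF e k] D_assoc[OF VA_hom[OF e] VA_hom[OF k] comult_hom[OF V HX]])
  then show ?thesis
    using \<kappa>_counit[of X] X V HX by (simp add: comonad_def)
qed

text \<open>Transposition commutes with precomposition by a coalgebra morphism. A factorisation of
  \<open>\<kappa> X\<close> after \<open>e\<close> in the base category can thereby be read as one
  of \<open>\<kappa>_ext X\<close> after \<open>e\<close>.\<close>

lemma \<kappa>_ext_comp:
  assumes X: "\<And>i. X i \<in> Ob (C i)" and e: "coalgebra_morphism D V p e (cofree V (fob H X))"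
  shows "\<kappa>_ext X \<bullet> e = VA (\<kappa> X \<bullet> e) \<bullet> snd p"
proof -
  have HX: "fob H X \<in> Ob D" using H_ob X by blast
  have k: "\<kappa> X \<in> hom D (VO (fob H X)) (fob H (WO X))" using \<kappa>_hom X by blast
  have eh: "e \<in> hom D (fst p) (VO (fob H X))"
    and ec: "comult V (fob H X) \<bullet> e = VA e \<bullet> snd p"
    using coalgebra_morphism_hom[OF e] coalgebra_morphism_commutes[OF e] by (auto simp: cofree_def)
  have p: "snd p \<in> hom D (fst p) (VO (fst p))"
    using coalgebra_morphism_coalgebra(1)[OF e] by (auto simp: coalgebra_def split: prod.splits)
  show ?thesis
    unfolding \<kappa>_ext_def
    by (simp add: D_assoc[OF VA_hom[OF k] comult_hom[OF V HX] eh] ec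
        D_assoc[OF VA_hom[OF k] VA_hom[OF eh] p] VA_comp[OF k eh])
qed

text \<open>At cofree coalgebras the structure maps are comultiplications, so the bimorphism
  equation is the comultiplication axiom of \<kappa> precomposed with \<open>e\<close>. With a path
  as source, this makes (S2'') applicable.\<close>

lemma bimorphism_\<kappa>_comp:
  assumes X: "\<And>i. X i \<in> Ob (C i)" and e: "coalgebra_morphism D V p e (cofree V (fob H X))"
  shows "bimorphism C W D V H \<kappa> p (\<lambda>i. cofree (W i) (X i)) (\<kappa> X \<bullet> e)"
proof -
  have HX: "fob H X \<in> Ob D" using H_ob X by blast
  have k: "\<kappa> X \<in> hom D (VO (fob H X)) (fob H (WO X))" using \<kappa>_hom X by blast
  have kW: "\<kappa> (WO X) \<in> hom D (VO (fob H (WO X))) (fob H (WO (WO X)))"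
    using \<kappa>_hom[of "WO X"] WO_ob[of X] X by blast
  have d: "farr H (\<lambda>i. comult (W i) (X i)) \<in> hom D (fob H (WO X)) (fob H (WO (WO X)))"
    using comult_hom[OF W] X by (intro H_hom) blast
  have x: "\<kappa>_ext X \<in> hom D (VO (fob H X)) (VO (fob H (WO X)))" using \<kappa>_ext_hom X by blast
  have eh: "e \<in> hom D (fst p) (VO (fob H X))"
    using coalgebra_morphism_hom[OF e] by (auto simp: cofree_def)
  have "farr H (\<lambda>i. comult (W i) (X i)) \<bullet> \<kappa> X \<bullet> e = (\<kappa> (WO X) \<bullet> \<kappa>_ext X) \<bullet> e"
    using \<kappa>_comult[of X] X by (simp add: D_assoc[OF d k eh, symmetric] \<kappa>_ext_def)
  also have "\<dots> = \<kappa> (WO X) \<bullet> VA (\<kappa> X \<bullet> e) \<bullet> snd p"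
    by (simp add: D_assoc[OF kW x eh] \<kappa>_ext_comp[OF X e])
  finally show ?thesis
    using coalgebra_morphism_coalgebra(1)[OF e] coalgebra_cofree[OF W X] D_hom[OF k eh]
    by (auto simp: bimorphism_def cofree_def split: prod.splits)
qed

section \<open>The action of the lifted functor on morphisms between cofree coalgebras\<close>

definition cofree_lift :: "('i \<Rightarrow> 'o) \<Rightarrow> ('i \<Rightarrow> 'o) \<Rightarrow> ('i \<Rightarrow> 'm) \<Rightarrow> 'n" where
  "cofree_lift A B f =
     VA (farr H (\<lambda>i. counit (W i) (B i)) \<bullet> farr H f \<bullet> \<kappa> A) \<bullet> comult V (fob H A)"

context
  fixes A B :: "'i \<Rightarrow> 'o" and f :: "'i \<Rightarrow> 'm"
  assumes A: "\<And>i. A i \<in> Ob (C i)" and B: "\<And>i. B i \<in> Ob (C i)"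
    and f: "\<And>i. coalgebra_morphism (C i) (W i) (cofree (W i) (A i)) (f i) (cofree (W i) (B i))"
begin

lemma f_hom: "f i \<in> hom (C i) (WO A i) (WO B i)"
  using coalgebra_morphism_hom[OF f] by (simp add: cofree_def)

lemma coalgebra_morphism_cofree_lift:
  "coalgebra_morphism D V (cofree V (fob H A)) (cofree_lift A B f) (cofree V (fob H B))"
proof -
  have "farr H (\<lambda>i. counit (W i) (B i)) \<bullet> farr H f \<bullet> \<kappa> A \<in> hom D (VO (fob H A)) (fob H B)"
    using D_hom[OF H_hom[OF counit_W_hom[of B]] D_hom[OF H_hom[OF f_hom] \<kappa>_hom[of A]]] A B by blast
  then show ?thesis
    using coalgebra_morphism_coextension[OF V] coalgebra_cofree[OF V H_ob[OF A]]
    unfolding cofree_lift_def cofree_def by blast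
qed

text \<open>This identifies the lift: the bimorphism H(f) after \<open>\<kappa> A\<close> factors as
  \<open>\<kappa> B\<close> after it. The transposing formula is thereby replaced by an equation in
  which only H(f) and \<kappa> remain.\<close>

lemma \<kappa>_cofree_lift: "\<kappa> B \<bullet> cofree_lift A B f = farr H f \<bullet> \<kappa> A"
proof -
  let ?e = "\<lambda>i. counit (W i) (B i)"
  note Hf = H_hom[OF f_hom]
  have e: "\<And>i. ?e i \<in> hom (C i) (WO B i) (B i)" using counit_hom[OF W] B by blast
  have We: "\<And>i. WA ?e i \<in> hom (C i) (WO (WO B) i) (WO B i)"
    using functor_hom[OF comonad_functor[OF W] e] by blast
  have Wf: "\<And>i. WA f i \<in> hom (C i) (WO (WO A) i) (WO (WO B) i)"
    using functor_hom[OF comonad_functor[OF W] f_hom] by blast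
  have dA: "\<And>i. comult (W i) (A i) \<in> hom (C i) (WO A i) (WO (WO A) i)"
    using comult_hom[OF W] A by blast
  have dB: "\<And>i. comult (W i) (B i) \<in> hom (C i) (WO B i) (WO (WO B) i)"
    using comult_hom[OF W] B by blast
  note He = H_hom[OF e] and HWe = H_hom[OF We] and HWf = H_hom[OF Wf]
    and HdA = H_hom[OF dA] and HdB = H_hom[OF dB]
  have k: "\<kappa> A \<in> hom D (VO (fob H A)) (fob H (WO A))" using \<kappa>_hom A by blast
  have kB: "\<kappa> B \<in> hom D (VO (fob H B)) (fob H (WO B))" using \<kappa>_hom B by blast
  have kWA: "\<kappa> (WO A) \<in> hom D (VO (fob H (WO A))) (fob H (WO (WO A)))"
    using \<kappa>_hom[of "WO A"] WO_ob[of A] A by blast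
  have kWB: "\<kappa> (WO B) \<in> hom D (VO (fob H (WO B))) (fob H (WO (WO B)))"
    using \<kappa>_hom[of "WO B"] WO_ob[of B] B by blast
  have x: "\<kappa>_ext A \<in> hom D (VO (fob H A)) (VO (fob H (WO A)))" using \<kappa>_ext_hom A by blast
  have d: "comult V (fob H A) \<in> hom D (VO (fob H A)) (VO (VO (fob H A)))"
    using comult_hom[OF V H_ob] A by blast
  have fcomm: "comult (W i) (B i) \<cdot>\<^bsub>C i\<^esub> f i = WA f i \<cdot>\<^bsub>C i\<^esub> comult (W i) (A i)" for i
    using coalgebra_morphism_commutes[OF f] by (simp add: cofree_def)
  \<comment> \<open>The comonad law W(\<epsilon>) after \<delta> = id holds at each index, and H
    carries the tuple of identities to an identity.\<close>
  have split: "farr H (WA ?e) \<bullet> farr H (\<lambda>i. comult (W i) (B i)) = Ident D (fob H (WO B))"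
    using H_comp[OF We dB] W B functor_Ident[OF H, of "WO B"] WO_ob[of B]
    by (simp add: comonad_def prod_cat_Ob prod_cat_Ident)
  have "cofree_lift A B f = VA (farr H ?e) \<bullet> VA (farr H f) \<bullet> \<kappa>_ext A"
    unfolding cofree_lift_def \<kappa>_ext_def
    by (simp add: VA_comp[OF He D_hom[OF Hf k]] VA_comp[OF Hf k]
        D_assoc[OF VA_hom[OF Hf] VA_hom[OF k] d]
        D_assoc[OF VA_hom[OF He] D_hom[OF VA_hom[OF Hf] VA_hom[OF k]] d])
  then have "\<kappa> B \<bullet> cofree_lift A B f = (\<kappa> B \<bullet> VA (farr H ?e)) \<bullet> VA (farr H f) \<bullet> \<kappa>_ext A"
    by (simp add: D_assoc[OF kB VA_hom[OF He] D_hom[OF VA_hom[OF Hf] x]])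
  \<comment> \<open>Naturality of \<kappa> is used first at the counits and then at
    \<open>f\<close>, so that \<kappa> ends up next to \<open>\<kappa>_ext A\<close>, where the
    comultiplication axiom applies.\<close>
  also have "\<dots> = farr H (WA ?e) \<bullet> (\<kappa> (WO B) \<bullet> VA (farr H f)) \<bullet> \<kappa>_ext A"
    unfolding \<kappa>_naturality[of ?e, OF e]
    by (simp add: D_assoc[OF HWe kWB D_hom[OF VA_hom[OF Hf] x]] D_assoc[OF kWB VA_hom[OF Hf] x])
  also have "\<dots> = farr H (WA ?e) \<bullet> farr H (WA f) \<bullet> \<kappa> (WO A) \<bullet> \<kappa>_ext A"
    unfolding \<kappa>_naturality[of f, OF f_hom] by (simp add: D_assoc[OF HWf kWA x])
  also have "\<dots> = farr H (WA ?e) \<bullet> (farr H (WA f) \<bullet> farr H (\<lambda>i. comult (W i) (A i))) \<bullet> \<kappa> A"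
    using \<kappa>_comult[of A] A by (simp add: \<kappa>_ext_def D_assoc[OF HWf HdA k])
  \<comment> \<open>Each \<open>f i\<close> is a coalgebra morphism, so the comultiplication can be
    moved to its other side, where the counits cancel it.\<close>
  also have "\<dots> = farr H (WA ?e) \<bullet> farr H (\<lambda>i. comult (W i) (B i)) \<bullet> farr H f \<bullet> \<kappa> A"
    using H_comp[OF Wf dA] H_comp[OF dB f_hom] fcomm D_assoc[OF HdB Hf k] by simp
  also have "\<dots> = farr H f \<bullet> \<kappa> A"
    by (simp add: D_assoc[OF HWe HdB D_hom[OF Hf k], symmetric] split comp_Ident_left[OF cat D_hom[OF Hf k]])
  finally show ?thesis .
qed

lemma pathwise_embedding_cofree_lift:
  assumes pfs: "proper_factorisation_system D E\<^sub>D M\<^sub>D"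
    and VM: "preserves_embeddings M\<^sub>D M\<^sub>D (cfun V)" and HM: "preserves_embeddings (tuples M) M\<^sub>D H"
    and S2: "S2'' C W M P D V Q H \<kappa>"
    and fpe: "\<And>i. pathwise_embedding (EM (C i) (W i)) (EM_lift (C i) (W i) (M i)) (P i)
                (cofree (W i) (A i), f i, cofree (W i) (B i))"
  shows "pathwise_embedding (EM D V) (EM_lift D V M\<^sub>D) Q
           (cofree V (fob H A), cofree_lift A B f, cofree V (fob H B))"
proof -
  let ?h = "cofree_lift A B f"
  note h = coalgebra_morphism_cofree_lift
  \<comment> \<open>Embeddings of coalgebras are detected on underlying morphisms, so it suffices to
    argue in \<open>D\<close>.\<close>
  have "?h \<bullet> e \<in> M\<^sub>D"
    if e: "coalgebra_morphism D V p e (cofree V (fob H A))" and eM: "e \<in> M\<^sub>D" and p: "p \<in> Q" for p e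
  proof -
    note kA = \<kappa>_hom[of A, OF A] and Hf = H_hom[OF f_hom]
    have eh: "e \<in> hom D (fst p) (VO (fob H A))"
      using coalgebra_morphism_hom[OF e] by (simp add: cofree_def)
    have hh: "?h \<in> hom D (VO (fob H A)) (VO (fob H B))"
      using coalgebra_morphism_hom[OF h] by (simp add: cofree_def)
    have \<pi>: "snd p \<in> hom D (fst p) (VO (fst p))"
      using coalgebra_morphism_coalgebra(1)[OF e] by (auto simp: coalgebra_def split: prod.splits)
    have "\<forall>i. cofree (W i) (A i) \<in> Ob (EM (C i) (W i))"
      using coalgebra_cofree[OF W A] by (simp add: EM_Ob)
    then obtain R m f\<^sub>0 where
      m: "\<And>i. path_embedding (EM (C i) (W i)) (EM_lift (C i) (W i) (M i)) (P i)
                (R i, m i, cofree (W i) (A i))"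
      and f\<^sub>0: "f\<^sub>0 \<in> hom D (fst p) (fob H (\<lambda>i. fst (R i)))"
      and decomp: "\<kappa> A \<bullet> e = farr H m \<bullet> f\<^sub>0"
      using S2[unfolded S2''_def, rule_format, OF p, of "\<lambda>i. cofree (W i) (A i)" "\<kappa> A \<bullet> e"]
        bimorphism_\<kappa>_comp[of A, OF A e] by auto
    have mm: "coalgebra_morphism (C i) (W i) (R i) (m i) (cofree (W i) (A i))" for i
      using m by (simp add: path_embedding_def EM_lift_iff)
    have mh: "m i \<in> hom (C i) (fst (R i)) (WO A i)" for i
      using coalgebra_morphism_hom[OF mm] by (simp add: cofree_def)
    \<comment> \<open>The pathwise-embedding hypothesis enters here: the \<open>m i\<close> supplied
      by (S2'') are path embeddings into the domain of \<open>f i\<close>.\<close>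
    have fmM: "f i \<cdot>\<^bsub>C i\<^esub> m i \<in> M i" for i
      using conjunct2[OF fpe[of i, unfolded pathwise_embedding_def], rule_format, OF m[of i]]
      by (simp add: EM_Dom EM_Cod EM_Comp EM_lift_iff)
    note Hm = H_hom[OF mh]
    have fm: "f i \<cdot>\<^bsub>C i\<^esub> m i \<in> hom (C i) (fst (R i)) (WO B i)" for i
      using comp_hom[OF comonad_category[OF W] f_hom mh] .
    note Hfm = H_hom[OF fm]
    \<comment> \<open>The map \<open>f\<^sub>0\<close> is merely a morphism of \<open>D\<close>, and
      the splitting is available only for \<open>\<kappa>_ext A\<close>. Hence the argument works
      with the transpose of \<open>f\<^sub>0\<close>, which will be shown to be an
      embedding.\<close>
    let ?t = "VA f\<^sub>0 \<bullet> snd p"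
    have t: "?t \<in> hom D (fst p) (VO (fob H (\<lambda>i. fst (R i))))"
      by (rule D_hom[OF VA_hom[OF f\<^sub>0] \<pi>])
    have "\<kappa>_ext A \<bullet> e = VA (farr H m) \<bullet> ?t"
      by (simp add: \<kappa>_ext_comp[of A, OF A e] decomp VA_comp[OF Hm f\<^sub>0]
          D_assoc[OF VA_hom[OF Hm] VA_hom[OF f\<^sub>0] \<pi>])
    moreover have "\<kappa>_ext A \<in> M\<^sub>D"
      using split_mono_embedding[OF pfs \<kappa>_ext_hom[of A, OF A] VA_hom[OF H_hom[OF counit_W_hom[of A]]] \<kappa>_ext_split[of A]] A
      by blast
    ultimately have "VA (farr H m) \<bullet> ?t \<in> M\<^sub>D"
      using embedding_comp[OF pfs eh eM \<kappa>_ext_hom[of A, OF A]] by metis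
    then have tM: "?t \<in> M\<^sub>D"
      by (rule embedding_cancel[OF pfs t VA_hom[OF Hm]])
    \<comment> \<open>Preservation of embeddings is applied to the composites of \<open>f i\<close>
      and \<open>m i\<close>, since no \<open>f i\<close> is itself known to be an
      embedding.\<close>
    have "farr H (\<lambda>i. f i \<cdot>\<^bsub>C i\<^esub> m i) \<in> M\<^sub>D"
      using HM fmM by (auto simp: preserves_embeddings_def tuples_def)
    then have "VA (farr H (\<lambda>i. f i \<cdot>\<^bsub>C i\<^esub> m i)) \<in> M\<^sub>D"
      using VM by (simp add: preserves_embeddings_def)
    then have "VA (farr H (\<lambda>i. f i \<cdot>\<^bsub>C i\<^esub> m i)) \<bullet> ?t \<in> M\<^sub>D"
      by (rule embedding_comp[OF pfs t tM VA_hom[OF Hfm]])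
    \<comment> \<open>The same \<open>?t\<close> reappears, now with \<open>m i\<close> replaced by
      its composite with \<open>f i\<close>. The equation is first proved for \<kappa> and then
      transposed.\<close>
    moreover have "\<kappa>_ext B \<bullet> ?h \<bullet> e = VA (farr H (\<lambda>i. f i \<cdot>\<^bsub>C i\<^esub> m i)) \<bullet> ?t"
    proof -
      have "\<kappa> B \<bullet> ?h \<bullet> e = farr H f \<bullet> \<kappa> A \<bullet> e"
        by (simp add: D_assoc[OF \<kappa>_hom[of B, OF B] hh eh, symmetric] \<kappa>_cofree_lift D_assoc[OF Hf kA eh])
      also have "\<dots> = farr H (\<lambda>i. f i \<cdot>\<^bsub>C i\<^esub> m i) \<bullet> f\<^sub>0"
        by (simp add: decomp H_comp[OF f_hom mh] D_assoc[OF Hf Hm f\<^sub>0])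
      finally show ?thesis
        by (simp add: \<kappa>_ext_comp[of B, OF B coalgebra_morphism_comp[OF V e h]] VA_comp[OF Hfm f\<^sub>0]
            D_assoc[OF VA_hom[OF Hfm] VA_hom[OF f\<^sub>0] \<pi>])
    qed
    ultimately have "\<kappa>_ext B \<bullet> ?h \<bullet> e \<in> M\<^sub>D"
      by simp
    then show ?thesis
      by (rule embedding_cancel[OF pfs D_hom[OF hh eh] \<kappa>_ext_hom[of B, OF B]])
  qed
  then show ?thesis
    using h coalgebra_morphism_comp[OF V _ h]
    by (auto simp: pathwise_embedding_def path_embedding_def EM_Arr EM_Dom EM_Cod EM_Comp EM_lift_iff)
qed

end

end

theorem theorem7p1:
  fixes C :: "'i::finite \<Rightarrow> ('o, 'm) cat"
    and W :: "'i \<Rightarrow> ('o, 'm) cmnd"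
    and E M :: "'i \<Rightarrow> 'm set"
    and P :: "'i \<Rightarrow> ('o \<times> 'm) set"
    and D :: "('p, 'n) cat"
    and V :: "('p, 'n) cmnd"
    and E\<^sub>D M\<^sub>D :: "'n set"
    and Q :: "('p \<times> 'n) set"
    and H :: "('i \<Rightarrow> 'o, 'i \<Rightarrow> 'm, 'p, 'n) fnctr"
    and \<kappa> :: "('i \<Rightarrow> 'o) \<Rightarrow> 'n"
    and A B :: "'i \<Rightarrow> 'o"
  assumes "\<And>i. comonad (C i) (W i)"
    and "comonad D V"
    and "\<And>i. proper_factorisation_system (C i) (E i) (M i)"
    and "proper_factorisation_system D E\<^sub>D M\<^sub>D"
    and "\<And>i. preserves_embeddings (M i) (M i) (cfun (W i))"
    and "preserves_embeddings M\<^sub>D M\<^sub>D (cfun V)"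
    and "\<And>i. path_category (EM (C i) (W i))
                (EM_lift (C i) (W i) (E i)) (EM_lift (C i) (W i) (M i)) (P i)"
    and "path_category (EM D V) (EM_lift D V E\<^sub>D) (EM_lift D V M\<^sub>D) Q"
    and "has_equalisers (EM D V)"
    and "is_functor (prod_cat C) D H"
    and "preserves_embeddings (tuples M) M\<^sub>D H"
    and "kleisli_law C W D V H \<kappa>"
    and "S2'' C W M P D V Q H \<kappa>"
    and "\<And>i. A i \<in> Ob (C i)"
    and "\<And>i. B i \<in> Ob (C i)"
    and "\<And>i. arrow_e (C i) (W i) (M i) (P i) (A i) (B i)"
  shows "arrow_e D V M\<^sub>D Q (fob H A) (fob H B)"
proof -
  interpret kleisli C W D V H \<kappa>
    using assms by unfold_locales
  have "\<exists>g. coalgebra_morphism (C i) (W i) (cofree (W i) (A i)) g (cofree (W i) (B i)) \<and>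
      pathwise_embedding (EM (C i) (W i)) (EM_lift (C i) (W i) (M i)) (P i)
        (cofree (W i) (A i), g, cofree (W i) (B i))" for i
    using assms(16)[of i] by (auto simp: arrow_e_def EM_hom)
  \<comment> \<open>The index-wise witnesses are assembled into one tuple by choice, as H acts on
    tuples of morphisms.\<close>
  then obtain f where
    f: "\<And>i. coalgebra_morphism (C i) (W i) (cofree (W i) (A i)) (f i) (cofree (W i) (B i))"
    and fpe: "\<And>i. pathwise_embedding (EM (C i) (W i)) (EM_lift (C i) (W i) (M i)) (P i)
                (cofree (W i) (A i), f i, cofree (W i) (B i))"
    by metis
  show ?thesis
    unfolding arrow_e_def Bex_def EM_hom
    using coalgebra_morphism_cofree_lift[OF assms(14,15) f]
      pathwise_embedding_cofree_lift[OF assms(14,15) f assms(4,6,11,13) fpe]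
    by blast
qed

end
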